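(* If $G$ is a block graph with blocks $B_1,B_2,\dots,B_\ell$, then $d_\Delta(G)=\ell+1$.
   Context: All graphs are finite, simple, undirected and connected. A block of $G$ is a maximal connected subgraph of $G$ without a cut vertex (so a bridge together with its ends is a block); $G$ is a block graph if every block is a complete graph. For $S\subseteq V(G)$, the $\Delta$-interval $[S]$ is the set consisting of all vertices of $S$ together with every vertex $v$ adjacent to both $x$ and $y$ for some pair of adjacent vertices $x,y\in S$. A set $S$ is $\Delta$-convex if $[S]=S$, and $\langle S\rangle$ denotes the smallest $\Delta$-convex set containing $S$ ($\langle\emptyset\rangle=\emptyset$). A set $S$ is convexly independent if $a\notin\langle S\setminus\{a\}\rangle$ for every $a\in S$. The rank $d_\Delta(G)$ is the least integer $n\ge0$ such that every $S\subseteq V(G)$ with $|S|>n$ is not convexly independent (equivalently, the maximum size of a convexly independent set).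
   Formalization: The formal theorem assumes that G has at least two vertices; for the one-vertex graph the claim fails, since its only block is itself (so ℓ+1=2) while its rank is 1. *)

theory Defs
  imports "Graph_Theory.Graph_Theory" "HOL.Hull"
begin

(* A finite simple undirected graph is a graph in the sense of the locale graph, that is, a finite
   symmetric digraph without loops and multiple arcs; adjacency of u and v is u \<rightarrow>\<^bsub>G\<^esub> v. *)

(* A cut vertex separates two other vertices of the same component.  This is preferred over
   "G minus v is not connected", because the library's null graph is not connected, which
   would turn the vertex of a one-vertex graph into a cut vertex. *)
definition cut_vertex :: "('a,'b) pre_digraph \<Rightarrow> 'a \<Rightarrow> bool" where
  "cut_vertex G v \<longleftrightarrow> v \<in> verts G \<and>
     (\<exists>x \<in> verts G - {v}. \<exists>y \<in> verts G - {v}.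
        x \<rightarrow>\<^sup>*\<^bsub>G\<^esub> y \<and> \<not> x \<rightarrow>\<^sup>*\<^bsub>pre_digraph.del_vert G v\<^esub> y)"

(* The condition graph H is needed because a subgraph of a symmetric digraph
   need not be symmetric. *)
definition blocks :: "('a,'b) pre_digraph \<Rightarrow> ('a,'b) pre_digraph set" where
  "blocks G = {B. pre_digraph.max_subgraph G
     (\<lambda>H. graph H \<and> connected H \<and> \<not> (\<exists>v. cut_vertex H v)) B}"

definition block_graph :: "('a,'b) pre_digraph \<Rightarrow> bool" where
  "block_graph G \<longleftrightarrow> graph G \<and> connected G \<and> (\<forall>B \<in> blocks G. \<exists>n. complete_digraph n B)"

definition delta_interval :: "('a,'b) pre_digraph \<Rightarrow> 'a set \<Rightarrow> 'a set" where
  "delta_interval G S = S \<union> {v. \<exists>x \<in> S. \<exists>y \<in> S. x \<rightarrow>\<^bsub>G\<^esub> y \<and> v \<rightarrow>\<^bsub>G\<^esub> x \<and> v \<rightarrow>\<^bsub>G\<^esub> y}"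

definition delta_convex :: "('a,'b) pre_digraph \<Rightarrow> 'a set \<Rightarrow> bool" where
  "delta_convex G S \<longleftrightarrow> S \<subseteq> verts G \<and> delta_interval G S = S"

definition delta_hull :: "('a,'b) pre_digraph \<Rightarrow> 'a set \<Rightarrow> 'a set" where
  "delta_hull G S = delta_convex G hull S"

lemma (in wf_digraph) delta_hull_is_least:
  assumes "S \<subseteq> verts G"
  shows "delta_convex G (delta_hull G S)" and "S \<subseteq> delta_hull G S"
    and "delta_convex G T \<Longrightarrow> S \<subseteq> T \<Longrightarrow> delta_hull G S \<subseteq> T"
proof -
  have *: "delta_convex G (verts G)"
    unfolding delta_convex_def delta_interval_def by (auto dest: adj_in_verts)
  show "delta_convex G (delta_hull G S)"
  proof -
    have "delta_hull G S \<subseteq> verts G"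
      using * assms unfolding delta_hull_def by (intro hull_minimal)
    moreover have "v \<in> delta_hull G S"
      if "x \<in> delta_hull G S" "y \<in> delta_hull G S" "x \<rightarrow>\<^bsub>G\<^esub> y" "v \<rightarrow>\<^bsub>G\<^esub> x" "v \<rightarrow>\<^bsub>G\<^esub> y" for v x y
      unfolding delta_hull_def hull_def
    proof (rule InterI)
      fix T assume "T \<in> {T. delta_convex G T \<and> S \<subseteq> T}"
      then have T: "delta_convex G T" "delta_hull G S \<subseteq> T"
        unfolding delta_hull_def by (simp_all add: hull_minimal)
      then have "x \<in> T" "y \<in> T" using that by blast+
      then have "v \<in> delta_interval G T" unfolding delta_interval_def using that by blast
      then show "v \<in> T" using T unfolding delta_convex_def by simp
    qed
    ultimately show ?thesis unfolding delta_convex_def delta_interval_def by blast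
  qed
  show "S \<subseteq> delta_hull G S" unfolding delta_hull_def by (rule hull_subset)
  show "delta_convex G T \<Longrightarrow> S \<subseteq> T \<Longrightarrow> delta_hull G S \<subseteq> T"
    unfolding delta_hull_def by (rule hull_minimal)
qed

definition convexly_independent :: "('a,'b) pre_digraph \<Rightarrow> 'a set \<Rightarrow> bool" where
  "convexly_independent G S \<longleftrightarrow> S \<subseteq> verts G \<and> (\<forall>a \<in> S. a \<notin> delta_hull G (S - {a}))"

definition delta_rank :: "('a,'b) pre_digraph \<Rightarrow> nat" where
  "delta_rank G = (LEAST n. \<forall>S \<subseteq> verts G. card S > n \<longrightarrow> \<not> convexly_independent G S)"

end

theory Submission
  imports Defs
begin

text \<open>A block graph arises from a single vertex by gluing on its \<open>\<ell>\<close> blocks one at a time, each at one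
  vertex, and a set is \<open>\<Delta>\<close>-convex iff it contains every block that it meets twice. Gluing a block
  \<open>B\<close> at \<open>c\<close> raises the rank by exactly one: a vertex of \<open>B - {c}\<close> can be added to any independent
  set, and conversely an independent set has at most two vertices in \<open>B - {c}\<close>; if there are two,
  replacing both by \<open>c\<close> leaves an independent set of the smaller graph.\<close>

section \<open>Convexity over set systems, and trees of blocks\<close>

text \<open>These are the subspaces of a point-line geometry with points \<open>V\<close> and lines
  \<open>Bs\<close>; for a block graph the lines will be the vertex sets of the blocks.\<close>

definition line_convex :: "'a set \<Rightarrow> 'a set set \<Rightarrow> 'a set \<Rightarrow> bool" where
  "line_convex V Bs C \<longleftrightarrow> C \<subseteq> V \<and> (\<forall>B\<in>Bs. \<forall>x\<in>B \<inter> C. \<forall>y\<in>B \<inter> C. x \<noteq> y \<longrightarrow> B \<subseteq> C)"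

lemma line_convexI:
  assumes "C \<subseteq> V"
    and "\<And>B x y. B \<in> Bs \<Longrightarrow> x \<in> B \<Longrightarrow> y \<in> B \<Longrightarrow> x \<in> C \<Longrightarrow> y \<in> C \<Longrightarrow> x \<noteq> y \<Longrightarrow> B \<subseteq> C"
  shows "line_convex V Bs C"
  unfolding line_convex_def using assms by (metis IntD1 IntD2)

text \<open>Independence without hulls: \<open>a\<close> lies outside the hull of \<open>S - {a}\<close> iff some convex set separates
  the two.\<close>
definition line_independent :: "'a set \<Rightarrow> 'a set set \<Rightarrow> 'a set \<Rightarrow> bool" where
  "line_independent V Bs S \<longleftrightarrow>
     S \<subseteq> V \<and> (\<forall>a\<in>S. \<exists>C. line_convex V Bs C \<and> S - {a} \<subseteq> C \<and> a \<notin> C)"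

text \<open>The condition \<open>B \<noteq> {c}\<close> makes every gluing bring in a new vertex, so
  that \<open>B\<close> is a new line and \<open>card Bs\<close> counts the gluings.\<close>

inductive block_tree :: "'a set \<Rightarrow> 'a set set \<Rightarrow> bool" where
  vertex: "block_tree {v} {}"
| glue: "block_tree V Bs \<Longrightarrow> finite B \<Longrightarrow> V \<inter> B = {c} \<Longrightarrow> B \<noteq> {c} \<Longrightarrow>
           block_tree (V \<union> B) (insert B Bs)"

lemma block_tree_finite: "block_tree V Bs \<Longrightarrow> finite V \<and> finite Bs"
  by (induction rule: block_tree.induct) auto

lemma block_tree_subset: "block_tree V Bs \<Longrightarrow> B \<in> Bs \<Longrightarrow> B \<subseteq> V"
  by (induction rule: block_tree.induct) auto

text \<open>Old and new vertices are linked through the gluing vertex \<open>c\<close>. The chains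
  obtained here later become paths of the graph.\<close>

lemma block_tree_connected:
  assumes "block_tree V Bs" "u \<in> V" "v \<in> V"
  shows "(\<lambda>x y. \<exists>B\<in>Bs. x \<in> B \<and> y \<in> B)\<^sup>*\<^sup>* u v"
  using assms
proof (induction arbitrary: u v rule: block_tree.induct)
  case (vertex w)
  then show ?case by simp
next
  case (glue V Bs B c)
  let ?R = "\<lambda>x y. \<exists>B\<in>insert B Bs. x \<in> B \<and> y \<in> B"
  have "c \<in> V" "c \<in> B" using glue.hyps by auto
  have old: "?R\<^sup>*\<^sup>* x y" if "x \<in> V" "y \<in> V" for x y
    by (rule rtranclp_mono[THEN predicate2D, OF _ glue.IH[OF that]]) auto
  have "?R\<^sup>*\<^sup>* x c \<and> ?R\<^sup>*\<^sup>* c x" if "x \<in> V \<union> B" for x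
    using that old[of x c] old[of c x] \<open>c \<in> V\<close> \<open>c \<in> B\<close> by (cases "x \<in> V") auto
  with glue.prems show ?case by (meson rtranclp_trans)
qed

section \<open>Independent sets in a tree of blocks\<close>

text \<open>The trace on \<open>V\<close> of a separating convex set still separates, and it stays
  convex because the lines in \<open>Bs\<close> lie inside \<open>V\<close>.\<close>

lemma line_independent_restrict:
  assumes "line_independent V' (insert B Bs) S" "V \<subseteq> V'" "\<And>A. A \<in> Bs \<Longrightarrow> A \<subseteq> V"
  shows "line_independent V Bs (S \<inter> V)"
  unfolding line_independent_def
proof (intro conjI ballI)
  fix a assume a: "a \<in> S \<inter> V"
  then obtain C where "line_convex V' (insert B Bs) C" "S - {a} \<subseteq> C" "a \<notin> C"
    using assms(1) by (auto simp: line_independent_def)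
  moreover from this have "line_convex V Bs (C \<inter> V)"
    using assms(3) unfolding line_convex_def by blast
  ultimately show "\<exists>C. line_convex V Bs C \<and> S \<inter> V - {a} \<subseteq> C \<and> a \<notin> C"
    by (intro exI[of _ "C \<inter> V"]) auto
qed auto

lemma block_tree_independent_card_le:
  assumes "block_tree V Bs" "line_independent V Bs S"
  shows "card S \<le> card Bs + 1"
  using assms
proof (induction arbitrary: S rule: block_tree.induct)
  case (vertex v)
  then have "S \<subseteq> {v}" by (simp add: line_independent_def)
  then show ?case using card_mono[of "{v}" S] by simp
next
  case (glue V Bs B c)
  have sub: "\<And>A. A \<in> Bs \<Longrightarrow> A \<subseteq> V" using block_tree_subset[OF glue.hyps(1)] .
  have fin: "finite V" "finite Bs" using block_tree_finite[OF glue.hyps(1)] by auto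
  \<comment> \<open>Lines in \<open>Bs\<close> lie in \<open>V\<close>, whereas \<open>B\<close> has
    a vertex other than \<open>c\<close> and hence outside \<open>V\<close>.\<close>
  have "B \<notin> Bs" using sub[of B] glue.hyps by auto
  then have cB: "card (insert B Bs) = card Bs + 1" using fin by simp
  have S: "S \<subseteq> V \<union> B" using glue.prems by (simp add: line_independent_def)
  then have finS: "finite S" using fin glue.hyps finite_subset by blast
  have IS: "line_independent V Bs (S \<inter> V)"
    using line_independent_restrict[OF glue.prems] sub by auto
  show ?case
  proof (cases "\<exists>p q. p \<in> S - V \<and> q \<in> S - V \<and> p \<noteq> q")
    case False
    then have "card (S - V) \<le> 1" using finS by (auto simp: card_le_Suc0_iff_eq)
    moreover have "card S = card (S \<inter> V) + card (S - V)"
      using finS card_Int_Diff by auto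
    ultimately show ?thesis using glue.IH[OF IS] cB by simp
  next
    case True
    then obtain p q where pq: "p \<in> S" "q \<in> S" "p \<notin> V" "q \<notin> V" "p \<noteq> q" by auto
    then have "p \<in> B" "q \<in> B" using S by auto
    have Bsub: "B \<subseteq> C" if "line_convex (V \<union> B) (insert B Bs) C" "x \<in> C" "y \<in> C" "x \<in> B" "y \<in> B" "x \<noteq> y"
      for C x y using that unfolding line_convex_def by blast
    \<comment> \<open>A convex set separating a third vertex of \<open>S \<inter> B\<close> from the
      rest would contain \<open>p\<close> and \<open>q\<close>, hence all of
      \<open>B\<close>.\<close>
    have SB: "S \<inter> B \<subseteq> {p, q}"
    proof
      fix r assume r: "r \<in> S \<inter> B"
      show "r \<in> {p, q}"
      proof (rule ccontr)
        assume n: "r \<notin> {p, q}"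
        from r obtain C where "line_convex (V \<union> B) (insert B Bs) C" "S - {r} \<subseteq> C" "r \<notin> C"
          using glue.prems by (auto simp: line_independent_def)
        then show False using Bsub[of C p q] pq n r \<open>p \<in> B\<close> \<open>q \<in> B\<close> by auto
      qed
    qed
    have c: "c \<in> V" "c \<in> B" using glue.hyps by auto
    have "c \<notin> S" using SB c pq by auto
    have "line_independent V Bs (insert c (S \<inter> V))"
      unfolding line_independent_def
    proof (intro conjI ballI)
      fix a assume a: "a \<in> insert c (S \<inter> V)"
      \<comment> \<open>The set separating \<open>p\<close> from the rest of \<open>S\<close> also
        serves for \<open>c\<close>: it contains \<open>q\<close>, so if it contained
        \<open>c\<close> it would contain \<open>B\<close> and thus \<open>p\<close>. For any other
        \<open>a\<close>, the set separating \<open>a\<close> contains \<open>p\<close> and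
        \<open>q\<close>, hence \<open>c\<close>.\<close>
      define d where "d = (if a = c then p else a)"
      have "d \<in> S" using a pq by (auto simp: d_def)
      then obtain C where C: "line_convex (V \<union> B) (insert B Bs) C" "S - {d} \<subseteq> C" "d \<notin> C"
        using glue.prems by (auto simp: line_independent_def)
      have "line_convex V Bs (C \<inter> V)"
        using C(1) sub unfolding line_convex_def by blast
      moreover have "insert c (S \<inter> V) - {a} \<subseteq> C \<inter> V \<and> a \<notin> C \<inter> V"
      proof (cases "a = c")
        case True
        then have "q \<in> C" "p \<notin> C" using C pq by (auto simp: d_def)
        then have "c \<notin> C" using Bsub[OF C(1), of q c] c pq \<open>p \<in> B\<close> \<open>q \<in> B\<close> by auto
        then show ?thesis using True C pq by (auto simp: d_def)
      next
        case False
        then have "p \<in> C" "q \<in> C" using C pq a by (auto simp: d_def)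
        then have "c \<in> C" using Bsub[OF C(1), of p q] c pq \<open>p \<in> B\<close> \<open>q \<in> B\<close> by auto
        then show ?thesis using False C c by (auto simp: d_def)
      qed
      ultimately show "\<exists>C. line_convex V Bs C \<and> insert c (S \<inter> V) - {a} \<subseteq> C \<and> a \<notin> C" by blast
    qed (use c in auto)
    \<comment> \<open>The vertex \<open>c\<close> takes one of the \<open>card Bs + 1\<close>
      places, which is what leaves room for both \<open>p\<close> and \<open>q\<close> after
      \<open>B\<close> is added.\<close>
    from glue.IH[OF this] have "card (S \<inter> V) \<le> card Bs"
      using \<open>c \<notin> S\<close> finS by simp
    moreover have "S \<subseteq> (S \<inter> V) \<union> {p, q}" using S SB by auto
    then have "card S \<le> card ((S \<inter> V) \<union> {p, q})" using finS by (intro card_mono) auto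
    moreover have "\<dots> \<le> card (S \<inter> V) + card {p, q}" by (rule card_Un_le)
    ultimately show ?thesis using cB pq by simp
  qed
qed

lemma block_tree_independent_exists:
  assumes "block_tree V Bs"
  shows "\<exists>S. line_independent V Bs S \<and> card S = card Bs + 1"
  using assms
proof (induction rule: block_tree.induct)
  case (vertex v)
  have "line_independent {v} {} {v}"
    by (auto simp: line_independent_def line_convex_def)
  then show ?case by (intro exI[of _ "{v}"]) simp
next
  case (glue V Bs B c)
  have sub: "\<And>A. A \<in> Bs \<Longrightarrow> A \<subseteq> V" using block_tree_subset[OF glue.hyps(1)] .
  have fin: "finite V" "finite Bs" using block_tree_finite[OF glue.hyps(1)] by auto
  have "B \<notin> Bs" using sub[of B] glue.hyps by auto
  then have cB: "card (insert B Bs) = card Bs + 1" using fin by simp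
  have c: "c \<in> V" "c \<in> B" and VB: "\<And>x. x \<in> V \<Longrightarrow> x \<in> B \<Longrightarrow> x = c" using glue.hyps by auto
  obtain b where b: "b \<in> B" "b \<noteq> c" using glue.hyps by auto
  then have "b \<notin> V" using VB by auto
  obtain S where S: "line_independent V Bs S" "card S = card Bs + 1" using glue.IH by auto
  then have "S \<subseteq> V" by (simp add: line_independent_def)
  have "line_independent (V \<union> B) (insert B Bs) (insert b S)"
    unfolding line_independent_def
  proof (intro conjI ballI)
    fix a assume a: "a \<in> insert b S"
    show "\<exists>C. line_convex (V \<union> B) (insert B Bs) C \<and> insert b S - {a} \<subseteq> C \<and> a \<notin> C"
    proof (cases "a = b")
      case True
      have "line_convex (V \<union> B) (insert B Bs) V"
        using sub VB unfolding line_convex_def by blast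
      then show ?thesis using True \<open>S \<subseteq> V\<close> \<open>b \<notin> V\<close> by (intro exI[of _ V]) auto
    next
      case False
      then have "a \<in> S" using a by simp
      then obtain C where C: "line_convex V Bs C" "S - {a} \<subseteq> C" "a \<notin> C"
        using S by (auto simp: line_independent_def)
      have CV: "C \<subseteq> V" using C by (simp add: line_convex_def)
      have conv: "\<And>A x y. A \<in> Bs \<Longrightarrow> x \<in> A \<Longrightarrow> y \<in> A \<Longrightarrow> x \<in> C \<Longrightarrow> y \<in> C \<Longrightarrow> x \<noteq> y \<Longrightarrow> A \<subseteq> C"
        using C(1) unfolding line_convex_def by blast
      show ?thesis
      \<comment> \<open>If \<open>c\<close> is in \<open>C\<close>, then \<open>C\<close> must
        absorb all of \<open>B\<close> once it contains \<open>b\<close>; otherwise \<open>b\<close>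
        is its only vertex in \<open>B\<close> and nothing more is forced.\<close>
      proof (cases "c \<in> C")
        case True
        have "A \<inter> (C \<union> B) \<subseteq> C" if "A \<in> Bs" for A
          using sub[OF that] VB True by auto
        then have "A \<subseteq> C \<union> B"
          if "A \<in> Bs" "x \<in> A" "y \<in> A" "x \<in> C \<union> B" "y \<in> C \<union> B" "x \<noteq> y" for A x y
          using conv[of A x y] that by blast
        then have "line_convex (V \<union> B) (insert B Bs) (C \<union> B)"
          using CV by (intro line_convexI) auto
        moreover have "a \<notin> B" using VB \<open>a \<in> S\<close> \<open>S \<subseteq> V\<close> True C(3) by auto
        ultimately show ?thesis using C b by (intro exI[of _ "C \<union> B"]) auto
      next
        case False
        have "A \<inter> insert b C \<subseteq> C" if "A \<in> Bs" for A
          using sub[OF that] \<open>b \<notin> V\<close> by auto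
        then have "A \<subseteq> insert b C"
          if "A \<in> Bs" "x \<in> A" "y \<in> A" "x \<in> insert b C" "y \<in> insert b C" "x \<noteq> y" for A x y
          using conv[of A x y] that by blast
        moreover have "x = y" if "x \<in> B" "y \<in> B" "x \<in> insert b C" "y \<in> insert b C" for x y
          using that False CV VB by auto
        moreover have "insert b C \<subseteq> V \<union> B" using CV b(1) by auto
        ultimately have "line_convex (V \<union> B) (insert B Bs) (insert b C)"
          by (intro line_convexI) (assumption, metis insertE)
        then show ?thesis using C \<open>a \<noteq> b\<close> by (intro exI[of _ "insert b C"]) auto
      qed
    qed
  qed (use \<open>S \<subseteq> V\<close> b in auto)
  moreover have "card (insert b S) = card (insert B Bs) + 1"
    using S cB fin \<open>S \<subseteq> V\<close> \<open>b \<notin> V\<close> by (metis Suc_eq_plus1 card_insert_disjoint finite_subset subsetD)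
  ultimately show ?case by blast
qed

section \<open>Paths, induced subgraphs and maximality of blocks\<close>

lemma rtranclp_distinct_path:
  assumes "R\<^sup>*\<^sup>* x y"
  obtains xs where "xs \<noteq> []" "hd xs = x" "last xs = y" "distinct xs" "successively R xs"
proof -
  from assms have "\<exists>xs. xs \<noteq> [] \<and> hd xs = x \<and> last xs = y \<and> distinct xs \<and> successively R xs"
  proof (induction rule: rtranclp_induct)
    case base
    show ?case by (intro exI[of _ "[x]"]) simp
  next
    case (step y z)
    then obtain xs where xs: "xs \<noteq> []" "hd xs = x" "last xs = y" "distinct xs" "successively R xs"
      by blast
    show ?case
    proof (cases "z \<in> set xs")
      case True
      \<comment> \<open>A return to a vertex already visited is cut out by stopping the path
        there.\<close>
      then obtain ys zs where "xs = ys @ z # zs" by (auto simp: in_set_conv_decomp)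
      then show ?thesis using xs
        by (intro exI[of _ "ys @ [z]"]) (auto simp: successively_append_iff hd_append)
    next
      case False
      then show ?thesis using xs step
        by (intro exI[of _ "xs @ [z]"]) (auto simp: successively_append_iff)
    qed
  qed
  then show thesis using that by blast
qed

context graph
begin

lemma graph_induce: "W \<subseteq> verts G \<Longrightarrow> graph (G \<restriction> W)"
  by (meson digraphI_induced digraph.graphI induced_graph_imp_symmetric induced_induce sym_arcs)

text \<open>Connectedness is defined through the symmetric closure, which changes nothing for
  reachability in a symmetric digraph.\<close>

lemma connected_iff_reachable:
  "connected G \<longleftrightarrow> verts G \<noteq> {} \<and> (\<forall>u\<in>verts G. \<forall>v\<in>verts G. u \<rightarrow>\<^sup>*\<^bsub>G\<^esub> v)"
  unfolding connected_def strongly_connected_def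
  using reachable_mk_symmetric_eq[OF sym_arcs] by simp

lemma adj_induce: "u \<rightarrow>\<^bsub>G\<^esub> v \<Longrightarrow> u \<in> W \<Longrightarrow> v \<in> W \<Longrightarrow> u \<rightarrow>\<^bsub>G \<restriction> W\<^esub> v"
  by (auto simp: arcs_ends_conv)

lemma del_vert_induce: "pre_digraph.del_vert (G \<restriction> W) x = G \<restriction> (W - {x})"
  by (auto simp: pre_digraph.del_vert_def induce_subgraph_def)

lemma path_reachable_induce:
  assumes "xs \<noteq> []" "set xs \<subseteq> W" "successively (\<lambda>x y. x \<rightarrow>\<^bsub>G\<^esub> y) xs"
  shows "hd xs \<rightarrow>\<^sup>*\<^bsub>G \<restriction> W\<^esub> last xs"
proof -
  interpret W: wf_digraph "G \<restriction> W" by auto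
  show ?thesis using assms
  proof (induction xs rule: induct_list012)
    case (3 x y zs)
    then have "x \<rightarrow>\<^bsub>G \<restriction> W\<^esub> y" by (intro adj_induce) auto
    with 3 show ?case by (auto intro: W.adj_reachable_trans)
  qed auto
qed

text \<open>Letting \<open>X\<close> range over sets with at most one element treats connectedness
  (\<open>X = {}\<close>) and the absence of cut vertices (\<open>X = {v}\<close>) in one
  condition.\<close>

lemma no_cut_vertex_induce:
  assumes "W \<noteq> {}" "W \<subseteq> verts G"
    and reach: "\<And>X a b. (\<forall>x\<in>X. \<forall>y\<in>X. x = y) \<Longrightarrow> a \<in> W - X \<Longrightarrow> b \<in> W - X
       \<Longrightarrow> a \<rightarrow>\<^sup>*\<^bsub>G \<restriction> (W - X)\<^esub> b"
  shows "graph (G \<restriction> W) \<and> connected (G \<restriction> W) \<and> \<not> (\<exists>v. cut_vertex (G \<restriction> W) v)"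
proof -
  interpret W: graph "G \<restriction> W" using assms by (intro graph_induce)
  have "connected (G \<restriction> W)"
    using assms(1) reach[of "{}"] by (auto simp: W.connected_iff_reachable)
  moreover have "\<not> cut_vertex (G \<restriction> W) v" for v
    using reach[of "{v}"] by (auto simp: cut_vertex_def del_vert_induce)
  ultimately show ?thesis using W.graph_axioms by blast
qed

text \<open>This is the form in which maximality gets used: to put vertices into a block, adjoin
  them and check that deleting at most one vertex never disconnects the result.\<close>

lemma block_maximal:
  assumes "B \<in> blocks G" "verts B \<subseteq> W" "W \<subseteq> verts G"
    and reach: "\<And>X a b. (\<forall>x\<in>X. \<forall>y\<in>X. x = y) \<Longrightarrow> a \<in> W - X \<Longrightarrow> b \<in> W - X
       \<Longrightarrow> a \<rightarrow>\<^sup>*\<^bsub>G \<restriction> (W - X)\<^esub> b"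
  shows "W = verts B"
proof -
  have BG: "subgraph B G" and B: "connected B"
    and max: "\<And>H. H \<noteq> B \<Longrightarrow> subgraph B H \<Longrightarrow> subgraph H G \<Longrightarrow>
       \<not> (graph H \<and> connected H \<and> \<not> (\<exists>v. cut_vertex H v))"
    using assms(1) by (auto simp: blocks_def max_subgraph_def)
  have ne: "verts B \<noteq> {}" using B by (auto simp: connected_def strongly_connected_def)
  have "subgraph B (G \<restriction> W)"
    using BG assms(2) by (auto simp: subgraph_def compatible_def dest: wf_digraph.wellformed)
  moreover have "subgraph (G \<restriction> W) G" using assms(3) by (rule subgraph_induce_subgraphI)
  moreover have "graph (G \<restriction> W) \<and> connected (G \<restriction> W) \<and> \<not> (\<exists>v. cut_vertex (G \<restriction> W) v)"
    using no_cut_vertex_induce[OF _ assms(3) reach] ne assms(2) by blast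
  ultimately have "G \<restriction> W = B" using max by blast
  then show ?thesis by auto
qed

lemma block_verts_subset: "B \<in> blocks G \<Longrightarrow> verts B \<subseteq> verts G"
  by (auto simp: blocks_def max_subgraph_def)

lemma reachable_induce_clique:
  assumes "a \<in> W" "b \<in> W" "W \<subseteq> verts G" "a \<noteq> b \<Longrightarrow> a \<rightarrow>\<^bsub>G\<^esub> b"
  shows "a \<rightarrow>\<^sup>*\<^bsub>G \<restriction> W\<^esub> b"
proof -
  interpret W: wf_digraph "G \<restriction> W" by auto
  show ?thesis using assms by (cases "a = b") (auto intro!: adj_induce)
qed

lemma reachable_induce_edge:
  assumes "u \<rightarrow>\<^bsub>G\<^esub> v" "a \<in> {u, v} - X" "b \<in> {u, v} - X"
  shows "a \<rightarrow>\<^sup>*\<^bsub>G \<restriction> ({u, v} - X)\<^esub> b"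
  using assms adj_in_verts[OF assms(1)] graph_symmetric[OF assms(1)]
  by (intro reachable_induce_clique) auto

text \<open>The edge itself induces a connected subgraph without cut vertex; among all such
  subgraphs containing \<open>u\<close> and \<open>v\<close>, one with the most vertices and arcs is
  a block.\<close>

lemma edge_in_block:
  assumes uv: "u \<rightarrow>\<^bsub>G\<^esub> v"
  obtains B where "B \<in> blocks G" "u \<in> verts B" "v \<in> verts B"
proof -
  define P where "P H \<longleftrightarrow> graph H \<and> connected H \<and> \<not> (\<exists>v. cut_vertex H v)"
    for H :: "('a,'b) pre_digraph"
  define Q where "Q H \<longleftrightarrow> subgraph H G \<and> P H \<and> {u, v} \<subseteq> verts H" for H
  define f where "f H = card (verts H) + card (arcs H)" for H :: "('a,'b) pre_digraph"
  have V: "{u, v} \<subseteq> verts G" using adj_in_verts[OF uv] by auto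
  have "P (G \<restriction> {u, v})"
    unfolding P_def using V reachable_induce_edge[OF uv] by (intro no_cut_vertex_induce) auto
  then have "Q (G \<restriction> {u, v})" using V by (auto simp: Q_def intro: subgraph_induce_subgraphI)
  moreover have "\<forall>H. Q H \<longrightarrow> f H \<le> f G"
    unfolding Q_def f_def by (auto intro!: add_mono card_mono)
  \<comment> \<open>\<open>Suc\<close> appears because the maximum principle asks for a strict
    bound.\<close>
  ultimately obtain B where B: "Q B" and max: "\<And>H. Q H \<Longrightarrow> f H \<le> f B"
    using ex_has_greatest_nat[of Q _ f "Suc (f G)"] by (metis le_imp_less_Suc)
  have "\<not> P H" if "B \<noteq> H" "subgraph B H" "subgraph H G" for H
  proof
    assume "P H"
    then have "Q H" using B that by (auto simp: Q_def)
    then have le: "f H \<le> f B" by (rule max)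
    have fin: "finite (verts H)" "finite (arcs H)"
      using that(3) by (meson finite_subset finite_verts finite_arcs subgraphE)+
    have "card (verts B) \<le> card (verts H)" "card (arcs B) \<le> card (arcs H)"
      using that(2) fin by (auto intro!: card_mono)
    with le have "card (verts B) = card (verts H)" "card (arcs B) = card (arcs H)"
      by (auto simp: f_def)
    \<comment> \<open>Nested finite sets of equal size coincide, so a largest subgraph is also
      maximal under inclusion.\<close>
    then have "verts B = verts H" "arcs B = arcs H"
      using that(2) fin by (meson card_subset_eq subgraphE)+
    then have "B = H" using that(2) by (auto simp: subgraph_def compatible_def)
    with that(1) show False by blast
  qed
  then have "max_subgraph P B" using B by (intro max_subgraphI) (auto simp: Q_def)
  then have "B \<in> blocks G" by (simp add: blocks_def P_def[abs_def])
  with B show thesis using that by (auto simp: Q_def)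
qed

end

section \<open>Graphs whose blocks are complete\<close>

locale complete_blocks = graph +
  assumes connected: "connected G"
    and blocks_complete: "B \<in> blocks G \<Longrightarrow> \<exists>n. complete_digraph n B"
begin

lemma block_adj:
  assumes "B \<in> blocks G" "x \<in> verts B" "y \<in> verts B" "x \<noteq> y"
  shows "x \<rightarrow>\<^bsub>B\<^esub> y"
  using blocks_complete[OF assms(1)] assms(2-) by (auto simp: complete_digraph_def)

lemma block_clique:
  assumes "B \<in> blocks G" "x \<in> verts B" "y \<in> verts B" "x \<noteq> y"
  shows "x \<rightarrow>\<^bsub>G\<^esub> y"
  using block_adj[OF assms] assms(1) by (auto simp: blocks_def max_subgraph_def intro: adj_mono)

text \<open>The path together with \<open>B\<close> has no cut vertex: after deleting a vertex, each remaining vertex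
  of the path still reaches an end of the path, since the deleted vertex blocks at most one of the
  two directions.\<close>
lemma path_in_block:
  assumes B: "B \<in> blocks G" and xs: "xs \<noteq> []" "distinct xs" "successively (\<lambda>x y. x \<rightarrow>\<^bsub>G\<^esub> y) xs"
    and ends: "hd xs \<in> verts B" "last xs \<in> verts B" and sub: "set xs \<subseteq> verts G"
  shows "set xs \<subseteq> verts B"
proof -
  let ?W = "verts B \<union> set xs"
  have WV: "?W \<subseteq> verts G" using block_verts_subset[OF B] sub by auto
  have "?W = verts B"
  proof (rule block_maximal[OF B _ WV])
    fix X a b assume X: "\<forall>x\<in>X. \<forall>y\<in>X. x = (y::'a)" and ab: "a \<in> ?W - X" "b \<in> ?W - X"
    interpret W: graph "G \<restriction> (?W - X)" using WV by (intro graph_induce) auto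
    have core: "\<exists>c\<in>verts B - X. p \<rightarrow>\<^sup>*\<^bsub>G \<restriction> (?W - X)\<^esub> c" if p: "p \<in> ?W - X" for p
    proof (cases "p \<in> verts B")
      case True
      then show ?thesis using p by (intro bexI[of _ p]) auto
    next
      case False
      then have "p \<in> set xs" using p by simp
      then obtain ys zs where eq: "xs = ys @ p # zs" by (auto simp: in_set_conv_decomp)
      \<comment> \<open>The two halves of the path share only \<open>p\<close>, by distinctness, and
        \<open>p\<close> is not in \<open>X\<close>.\<close>
      have "set (ys @ [p]) \<inter> X = {} \<or> set (p # zs) \<inter> X = {}"
      proof (rule ccontr)
        assume "\<not> ?thesis"
        then obtain q r where "q \<in> set (ys @ [p])" "r \<in> set (p # zs)" "q \<in> X" "r \<in> X" by blast
        moreover from this have "q = r" using X by blast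
        ultimately show False using xs(2) p unfolding eq by auto
      qed
      then show ?thesis
      proof
        assume *: "set (ys @ [p]) \<inter> X = {}"
        have "hd (ys @ [p]) \<rightarrow>\<^sup>*\<^bsub>G \<restriction> (?W - X)\<^esub> last (ys @ [p])"
          using * xs(3) by (intro path_reachable_induce) (auto simp: eq successively_append_iff)
        moreover have "hd (ys @ [p]) = hd xs" by (simp add: eq hd_append)
        moreover have "hd (ys @ [p]) \<notin> X" using * by (cases ys) auto
        ultimately show ?thesis using ends(1) W.symmetric_reachable' by auto
      next
        assume *: "set (p # zs) \<inter> X = {}"
        have "hd (p # zs) \<rightarrow>\<^sup>*\<^bsub>G \<restriction> (?W - X)\<^esub> last (p # zs)"
          using * xs(3) by (intro path_reachable_induce) (auto simp: eq successively_append_iff)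
        moreover have "last (p # zs) = last xs" by (simp add: eq)
        moreover have "last (p # zs) \<notin> X" using * last_in_set[of "p # zs"] by blast
        ultimately show ?thesis using ends(2) by auto
      qed
    qed
    obtain c d where cd: "c \<in> verts B - X" "a \<rightarrow>\<^sup>*\<^bsub>G \<restriction> (?W - X)\<^esub> c"
      "d \<in> verts B - X" "b \<rightarrow>\<^sup>*\<^bsub>G \<restriction> (?W - X)\<^esub> d" using core ab by metis
    \<comment> \<open>The two exits into \<open>B\<close> are equal or adjacent, as \<open>B\<close>
      is complete.\<close>
    have "c \<rightarrow>\<^sup>*\<^bsub>G \<restriction> (?W - X)\<^esub> d"
      using cd WV block_clique[OF B] by (intro reachable_induce_clique) auto
    then show "a \<rightarrow>\<^sup>*\<^bsub>G \<restriction> (?W - X)\<^esub> b"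
      using cd by (meson W.reachable_trans W.symmetric_reachable')
  qed auto
  then show ?thesis by auto
qed

text \<open>Apply \<open>path_in_block\<close> to the path \<open>[x, v, y]\<close>.\<close>

lemma common_neighbour_in_block:
  assumes "B \<in> blocks G" "x \<in> verts B" "y \<in> verts B" "x \<noteq> y" "v \<rightarrow>\<^bsub>G\<^esub> x" "v \<rightarrow>\<^bsub>G\<^esub> y"
  shows "v \<in> verts B"
  using path_in_block[OF assms(1), of "[x, v, y]"] assms adj_in_verts graph_symmetric
    adj_not_same by (cases "v = x \<or> v = y") auto

text \<open>Any further vertex of one block is a common neighbour of \<open>x\<close> and
  \<open>y\<close>, hence lies in the other block.\<close>

lemma block_verts_eq:
  assumes "B \<in> blocks G" "B' \<in> blocks G" "{x, y} \<subseteq> verts B \<inter> verts B'" "x \<noteq> y"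
  shows "verts B = verts B'"
proof -
  have "verts C \<subseteq> verts D" if "C \<in> blocks G" "D \<in> blocks G" "{x, y} \<subseteq> verts C \<inter> verts D" for C D
    using that common_neighbour_in_block[OF that(2), of x y] block_clique[OF that(1)] assms(4) by blast
  then show ?thesis using assms by blast
qed

text \<open>Completeness puts an arc of \<open>B\<close> between the ends of every candidate arc,
  and without multiple arcs the two are the same. Blocks may therefore be counted by their vertex
  sets.\<close>

lemma block_induced:
  assumes "B \<in> blocks G"
  shows "B = G \<restriction> verts B"
proof -
  have BG: "subgraph B G" using assms by (simp add: blocks_def max_subgraph_def)
  then have th: "tail B = tail G" "head B = head G" by (auto simp: subgraph_def compatible_def)
  interpret B: wf_digraph B using BG by auto
  have "e \<in> arcs B" if e: "e \<in> arcs G" "tail G e \<in> verts B" "head G e \<in> verts B" for e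
  proof -
    have "tail G e \<rightarrow>\<^bsub>B\<^esub> head G e" using block_adj[OF assms e(2,3)] no_loops[OF e(1)] by simp
    then obtain e' where e': "e' \<in> arcs B" "tail B e' = tail G e" "head B e' = head G e" by auto
    then have "e' = e" using BG th e by (intro no_multi_arcs) (auto simp: arc_to_ends_def)
    with e' show ?thesis by simp
  qed
  moreover have "arcs B \<subseteq> arcs G" using BG by auto
  ultimately have "arcs B = {e \<in> arcs G. tail G e \<in> verts B \<and> head G e \<in> verts B}"
    using B.wellformed th by auto
  then show ?thesis using th by (simp add: induce_subgraph_def)
qed

lemma inj_on_verts_blocks: "inj_on verts (blocks G)"
  by (rule inj_onI) (metis block_induced)

text \<open>A block with a single vertex could be enlarged by an edge at that vertex, which exists
  since \<open>G\<close> is connected with at least two vertices.\<close>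

lemma block_two_vertices:
  assumes "B \<in> blocks G" "card (verts G) \<ge> 2"
  obtains x y where "x \<in> verts B" "y \<in> verts B" "x \<noteq> y"
proof -
  have "connected B" using assms(1) by (auto simp: blocks_def max_subgraph_def)
  then obtain v where v: "v \<in> verts B" by (auto simp: connected_def strongly_connected_def)
  have "verts B \<noteq> {v}"
  proof
    assume B: "verts B = {v}"
    have "verts G \<noteq> {v}" using assms(2) by auto
    moreover have vG: "v \<in> verts G" using block_verts_subset[OF assms(1)] v by auto
    ultimately obtain w where w: "w \<in> verts G" "w \<noteq> v" by auto
    then have "v \<rightarrow>\<^sup>*\<^bsub>G\<^esub> w" using connected vG by (auto simp: connected_iff_reachable)
    then obtain u where u: "v \<rightarrow>\<^bsub>G\<^esub> u" using w(2) by (auto elim: converse_reachable_cases)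
    have "{v, u} = verts B"
      using adj_in_verts[OF u] B reachable_induce_edge[OF u] by (intro block_maximal[OF assms(1)]) auto
    then show False using B u adj_not_same by auto
  qed
  then show thesis using that v by blast
qed

section \<open>From the graph to its tree of blocks\<close>

text \<open>Two vertices of a complete block have all its other vertices as common neighbours;
  conversely, a triangle lies in the block of any of its edges.\<close>

lemma delta_convex_iff:
  "delta_convex G C \<longleftrightarrow> line_convex (verts G) (verts ` blocks G) C"
proof
  assume C: "delta_convex G C"
  have "v \<in> C" if "B \<in> blocks G" "x \<in> verts B" "x \<in> C" "y \<in> verts B" "y \<in> C" "x \<noteq> y" "v \<in> verts B"
    for B x y v
  proof (cases "v = x \<or> v = y")
    case False
    then have "v \<in> delta_interval G C"
      using that block_clique[OF that(1)] unfolding delta_interval_def by blast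
    then show ?thesis using C by (simp add: delta_convex_def)
  qed (use that in auto)
  then show "line_convex (verts G) (verts ` blocks G) C"
    using C unfolding line_convex_def delta_convex_def by blast
next
  assume C: "line_convex (verts G) (verts ` blocks G) C"
  have "v \<in> C" if xy: "x \<in> C" "y \<in> C" "x \<rightarrow>\<^bsub>G\<^esub> y" "v \<rightarrow>\<^bsub>G\<^esub> x" "v \<rightarrow>\<^bsub>G\<^esub> y" for x y v
  proof -
    obtain B where B: "B \<in> blocks G" "x \<in> verts B" "y \<in> verts B" using edge_in_block[OF xy(3)] .
    have "x \<noteq> y" using xy(3) adj_not_same by auto
    with B have "v \<in> verts B" using common_neighbour_in_block xy by blast
    then show ?thesis using C B xy \<open>x \<noteq> y\<close> unfolding line_convex_def by blast
  qed
  then have "delta_interval G C = C" unfolding delta_interval_def by blast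
  then show "delta_convex G C" using C by (simp add: delta_convex_def line_convex_def)
qed

lemma convexly_independent_iff:
  "convexly_independent G S \<longleftrightarrow> line_independent (verts G) (verts ` blocks G) S"
  unfolding convexly_independent_def line_independent_def delta_hull_def hull_def delta_convex_iff
  by auto

text \<open>Otherwise a path from \<open>u\<close> to \<open>u'\<close> through the blocks in \<open>Bs\<close> stays in \<open>B\<close>, so its first edge
  lies in \<open>B\<close> and in another block.\<close>
lemma block_meets_block_tree:
  assumes U: "block_tree U Bs" "Bs \<subseteq> verts ` blocks G" "U \<subseteq> verts G"
    and B: "B \<in> blocks G" "verts B \<notin> Bs"
    and u: "u \<in> U" "u' \<in> U" "u \<in> verts B" "u' \<in> verts B"
  shows "u = u'"
proof (rule ccontr)
  assume "u \<noteq> u'"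
  let ?R = "\<lambda>x y. \<exists>A\<in>Bs. x \<in> A \<and> y \<in> A"
  from block_tree_connected[OF U(1) u(1,2)]
  obtain xs where xs: "xs \<noteq> []" "hd xs = u" "last xs = u'" "distinct xs" "successively ?R xs"
    by (rule rtranclp_distinct_path)
  \<comment> \<open>Since \<open>u \<noteq> u'\<close>, the path has a first edge, from
    \<open>u\<close> to \<open>x\<close>.\<close>
  obtain x ys where eq: "xs = u # x # ys"
    using xs \<open>u \<noteq> u'\<close> by (cases xs; cases "tl xs") auto
  have adj: "successively (\<lambda>x y. x \<rightarrow>\<^bsub>G\<^esub> y) xs"
    using xs(4,5)
  proof (induction xs rule: induct_list012)
    case (3 x y zs)
    then have "x \<noteq> y" by auto
    moreover obtain A where "A \<in> Bs" "x \<in> A" "y \<in> A" using 3 by auto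
    ultimately have "x \<rightarrow>\<^bsub>G\<^esub> y" using U(2) block_clique by auto
    with 3 show ?case by simp
  qed auto
  have "set xs \<subseteq> verts G"
  proof -
    have "z \<in> verts G" if "successively (\<lambda>x y. x \<rightarrow>\<^bsub>G\<^esub> y) zs" "hd zs \<in> verts G" "z \<in> set zs" for z zs
      using that by (induction zs rule: induct_list012) (auto dest: adj_in_verts)
    then show ?thesis using adj xs(2) u(1) U(3) by blast
  qed
  then have "x \<in> verts B" using path_in_block[OF B(1) xs(1,4) adj] xs(2,3) u eq by auto
  moreover obtain A where A: "A \<in> Bs" "u \<in> A" "x \<in> A" using xs(5) eq by auto
  moreover obtain B' where "B' \<in> blocks G" "A = verts B'" using A U(2) by auto
  moreover have "u \<noteq> x" using xs(4) eq by auto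
  ultimately show False using block_verts_eq[OF B(1), of B' u x] B(2) u(3) by auto
qed

text \<open>Take a maximal set \<open>Bs\<close> of blocks forming a tree on some \<open>U\<close>.
  If \<open>U\<close> missed a vertex, the block of an edge leaving \<open>U\<close> could be glued
  on. Once \<open>U\<close> is everything, a block outside \<open>Bs\<close> would meet
  \<open>U\<close> in two vertices, against \<open>block_meets_block_tree\<close>.\<close>

lemma block_tree_blocks:
  assumes "card (verts G) \<ge> 2"
  shows "block_tree (verts G) (verts ` blocks G)"
proof -
  let ?F = "{Bs. Bs \<subseteq> verts ` blocks G \<and> (\<exists>U\<subseteq>verts G. block_tree U Bs)}"
  have "verts ` blocks G \<subseteq> Pow (verts G)" using block_verts_subset by blast
  then have "finite (verts ` blocks G)" by (rule finite_subset) simp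
  then have fin: "finite ?F" by simp
  obtain v where "v \<in> verts G" using assms by fastforce
  then have "{} \<in> ?F" using block_tree.vertex[of v] by auto
  then have "?F \<noteq> {}" by (metis empty_iff)
  from finite_has_maximal[OF fin this]
  obtain Bs where Bs: "Bs \<in> ?F" and max: "\<forall>Bs'\<in>?F. Bs \<subseteq> Bs' \<longrightarrow> Bs = Bs'"
    by (rule bexE)
  from Bs obtain U where sub: "Bs \<subseteq> verts ` blocks G" and U: "U \<subseteq> verts G" "block_tree U Bs" by auto
  have "U \<noteq> {}" using U(2) by cases auto
  have "U = verts G"
  proof (rule ccontr)
    assume "U \<noteq> verts G"
    obtain u w where uw: "u \<in> U" "w \<notin> U" "u \<rightarrow>\<^bsub>G\<^esub> w"
    proof -
      obtain a b where ab: "a \<in> U" "b \<in> verts G" "b \<notin> U"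
        using \<open>U \<noteq> {}\<close> \<open>U \<noteq> verts G\<close> U(1) by blast
      then have "a \<rightarrow>\<^sup>*\<^bsub>G\<^esub> b" using connected U(1) by (auto simp: connected_iff_reachable)
      then have "\<exists>u w. u \<in> U \<and> w \<notin> U \<and> u \<rightarrow>\<^bsub>G\<^esub> w"
        using ab by (induction rule: reachable_induct) (auto dest: adj_in_verts)
      then show thesis using that by blast
    qed
    obtain B where B: "B \<in> blocks G" "u \<in> verts B" "w \<in> verts B" using edge_in_block[OF uw(3)] .
    have "verts B \<notin> Bs" using block_tree_subset[OF U(2)] B uw by auto
    then have "U \<inter> verts B = {u}"
      using block_meets_block_tree[OF U(2) sub U(1) B(1)] B uw by auto
    moreover have BV: "verts B \<subseteq> verts G" using block_verts_subset[OF B(1)] .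
    ultimately have "block_tree (U \<union> verts B) (insert (verts B) Bs)"
      using B uw U finite_subset[OF BV] by (intro block_tree.glue) auto
    moreover have "U \<union> verts B \<subseteq> verts G" using U(1) BV by simp
    ultimately have "insert (verts B) Bs \<in> ?F" using sub B(1) by blast
    from bspec[OF max this] \<open>verts B \<notin> Bs\<close> show False by (simp add: subset_insertI) blast
  qed
  moreover have "verts B \<in> Bs" if B: "B \<in> blocks G" for B
  proof (rule ccontr)
    assume "verts B \<notin> Bs"
    moreover obtain x y where "x \<in> verts B" "y \<in> verts B" "x \<noteq> y"
      using block_two_vertices[OF B assms] .
    ultimately show False
      using block_meets_block_tree[OF U(2) sub U(1) B] \<open>U = verts G\<close> block_verts_subset[OF B] by blast
  qed
  ultimately show ?thesis using sub U by (metis image_subsetI subset_antisym)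
qed

end

theorem theorem7:
  fixes G :: "('a,'b) pre_digraph"
  assumes "block_graph G"
    and "card (verts G) \<ge> 2"
  shows "delta_rank G = card (blocks G) + 1"
proof -
  interpret graph G using assms(1) by (simp add: block_graph_def)
  interpret complete_blocks G using assms(1) by unfold_locales (auto simp: block_graph_def)
  have T: "block_tree (verts G) (verts ` blocks G)" using block_tree_blocks[OF assms(2)] .
  have card: "card (verts ` blocks G) = card (blocks G)" using card_image[OF inj_on_verts_blocks] .
  \<comment> \<open>This set rules out every smaller bound in the \<open>LEAST\<close> of
    \<open>delta_rank\<close>.\<close>
  obtain S where "convexly_independent G S" "card S = card (blocks G) + 1"
    using block_tree_independent_exists[OF T] card by (auto simp: convexly_independent_iff)
  moreover have "card S \<le> card (blocks G) + 1" if "convexly_independent G S" for S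
    using block_tree_independent_card_le[OF T] that card by (simp add: convexly_independent_iff)
  ultimately show ?thesis
    unfolding delta_rank_def
    by (intro Least_equality) (fastforce simp: convexly_independent_def not_less)+
qed

end
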